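(* Let $\sigma_0,Q_0\in\mathbb{R}$ satisfy $$0<|\sigma_0|<\frac{\pi}{2},\qquad Q_0\le Q_{max}=-\frac{w^6(w^2+2)}{(1-w^2)(w^2+1)^3},\qquad w=\sqrt[3]{\tan\frac{\sigma_0}{2}}$$ (real cube root). Then there exist two parabolic spiral arcs $$x(t)=-(1-t)^2+2p(1-t)t+t^2,\qquad y(t)=2qt(1-t),\qquad 0\le t\le1,\quad q\neq0,$$ such that $Q(p,q)=Q_0$ and $\sigma(p,q)=\sigma_0$.
   Context: An arc is called spiral if its signed curvature is a monotone, nonconstant function of the parameter on $[0,1]$. For the parabolic arc with control point $(p,q)$, $q\neq0$, put $h_1=\sqrt{(1+p)^2+q^2}$, $h_2=\sqrt{(1-p)^2+q^2}$. Let $\alpha,\beta\in(-\pi,\pi)$ be the angles of the tangent vector at $t=0$ and $t=1$, given by $$\cos\alpha=\frac{1+p}{h_1},\quad \sin\alpha=\frac{q}{h_1},\qquad \cos\beta=\frac{1-p}{h_2},\quad \sin\beta=\frac{-q}{h_2},$$ and let $a=-q/h_1^3$, $b=-q/h_2^3$ be the signed curvatures at $t=0$ and $t=1$. Then $$\sigma(p,q)=\alpha+\beta,\qquad Q(p,q)=(a+\sin\alpha)(b-\sin\beta)+\sin^2\frac{\alpha+\beta}{2}.$$ *)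

theory Defs
  imports "HOL-Analysis.Analysis"
begin

definition signed_curvature :: "(real \<Rightarrow> real) \<Rightarrow> (real \<Rightarrow> real) \<Rightarrow> real \<Rightarrow> real" where
  "signed_curvature x y t =
     (deriv x t * deriv (deriv y) t - deriv y t * deriv (deriv x) t)
       / sqrt ((deriv x t)\<^sup>2 + (deriv y t)\<^sup>2) ^ 3"

definition spiral_arc :: "(real \<Rightarrow> real) \<Rightarrow> (real \<Rightarrow> real) \<Rightarrow> bool" where
  "spiral_arc x y \<longleftrightarrow>
     (mono_on {0..1} (signed_curvature x y) \<or> antimono_on {0..1} (signed_curvature x y)) \<and>
     \<not> signed_curvature x y constant_on {0..1}"

definition arc_x :: "real \<Rightarrow> real \<Rightarrow> real" where
  "arc_x p t = - (1 - t)\<^sup>2 + 2 * p * (1 - t) * t + t\<^sup>2"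

definition arc_y :: "real \<Rightarrow> real \<Rightarrow> real" where
  "arc_y q t = 2 * q * t * (1 - t)"

definition h1 :: "real \<Rightarrow> real \<Rightarrow> real" where
  "h1 p q = sqrt ((1 + p)\<^sup>2 + q\<^sup>2)"

definition h2 :: "real \<Rightarrow> real \<Rightarrow> real" where
  "h2 p q = sqrt ((1 - p)\<^sup>2 + q\<^sup>2)"

(* Both descriptions below determine the angle whenever q \<noteq> 0; see alpha_angle and beta_angle. *)

definition alpha :: "real \<Rightarrow> real \<Rightarrow> real" where
  "alpha p q = (THE \<theta>. - pi < \<theta> \<and> \<theta> < pi \<and>
     cos \<theta> = (1 + p) / h1 p q \<and> sin \<theta> = q / h1 p q)"

definition beta :: "real \<Rightarrow> real \<Rightarrow> real" where
  "beta p q = (THE \<theta>. - pi < \<theta> \<and> \<theta> < pi \<and>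
     cos \<theta> = (1 - p) / h2 p q \<and> sin \<theta> = - q / h2 p q)"

definition curv_a :: "real \<Rightarrow> real \<Rightarrow> real" where
  "curv_a p q = - q / h1 p q ^ 3"

definition curv_b :: "real \<Rightarrow> real \<Rightarrow> real" where
  "curv_b p q = - q / h2 p q ^ 3"

definition sigma :: "real \<Rightarrow> real \<Rightarrow> real" where
  "sigma p q = alpha p q + beta p q"

definition Q :: "real \<Rightarrow> real \<Rightarrow> real" where
  "Q p q = (curv_a p q + sin (alpha p q)) * (curv_b p q - sin (beta p q))
           + (sin ((alpha p q + beta p q) / 2))\<^sup>2"

lemma angle_unique:
  fixes u v r :: real
  assumes "v \<noteq> 0" and r: "r = sqrt (u\<^sup>2 + v\<^sup>2)"
  shows "\<exists>!\<theta>. - pi < \<theta> \<and> \<theta> < pi \<and> cos \<theta> = u / r \<and> sin \<theta> = v / r"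
proof -
  have pos: "u\<^sup>2 + v\<^sup>2 > 0"
    using assms(1) by (simp add: sum_power2_gt_zero_iff)
  have "(u / r)\<^sup>2 + (v / r)\<^sup>2 = 1"
    using pos assms(1) by (simp add: r power_divide flip: add_divide_distrib)
  then obtain t where t: "- pi < t" "t \<le> pi" "u / r = cos t" "v / r = sin t"
    by (metis sincos_principal_value sincos_total_2pi_le)
  have "r \<noteq> 0"
    unfolding r using pos by (metis less_irrefl real_sqrt_gt_zero)
  then have "t \<noteq> pi"
    using t(4) assms(1) by auto
  then have ex: "- pi < t \<and> t < pi \<and> cos t = u / r \<and> sin t = v / r"
    using t by simp
  show ?thesis
  proof (rule ex1I[of _ t], rule ex)
    fix s assume s: "- pi < s \<and> s < pi \<and> cos s = u / r \<and> sin s = v / r"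
    then have "sin s = sin t \<and> cos s = cos t"
      using ex by simp
    then obtain n :: int where n: "s = t + 2 * pi * n"
      using sin_cos_eq_iff by auto
    have "\<bar>2 * pi * n\<bar> < 2 * pi * 1"
      using s ex n by linarith
    then have "\<bar>real_of_int n\<bar> < 1"
      by (simp add: abs_mult)
    then have "n = 0"
      by linarith
    then show "s = t"
      using n by simp
  qed
qed

lemma alpha_angle:
  assumes "q \<noteq> 0"
  shows "- pi < alpha p q \<and> alpha p q < pi \<and>
    cos (alpha p q) = (1 + p) / h1 p q \<and> sin (alpha p q) = q / h1 p q"
  unfolding alpha_def using theI'[OF angle_unique[OF assms h1_def]] .

lemma beta_angle:
  assumes "q \<noteq> 0"
  shows "- pi < beta p q \<and> beta p q < pi \<and>
    cos (beta p q) = (1 - p) / h2 p q \<and> sin (beta p q) = - q / h2 p q"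
proof -
  have "h2 p q = sqrt ((1 - p)\<^sup>2 + (- q)\<^sup>2)"
    by (simp add: h2_def)
  with assms show ?thesis
    unfolding beta_def by (intro theI'[OF angle_unique]) auto
qed

lemma deriv_arc_x: "deriv (arc_x p) = (\<lambda>t. 2 + 2 * p * (1 - 2 * t))"
proof
  fix t
  show "deriv (arc_x p) t = 2 + 2 * p * (1 - 2 * t)"
    unfolding arc_x_def[abs_def]
    by (rule DERIV_imp_deriv) (auto intro!: derivative_eq_intros simp: algebra_simps)
qed

lemma deriv_arc_y: "deriv (arc_y q) = (\<lambda>t. 2 * q * (1 - 2 * t))"
proof
  fix t
  show "deriv (arc_y q) t = 2 * q * (1 - 2 * t)"
    unfolding arc_y_def[abs_def]
    by (rule DERIV_imp_deriv) (auto intro!: derivative_eq_intros simp: algebra_simps)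
qed

lemma deriv2_arc_x: "deriv (deriv (arc_x p)) t = - 4 * p"
  unfolding deriv_arc_x
  by (rule DERIV_imp_deriv) (auto intro!: derivative_eq_intros simp: algebra_simps)

lemma deriv2_arc_y: "deriv (deriv (arc_y q)) t = - 4 * q"
  unfolding deriv_arc_y
  by (rule DERIV_imp_deriv) (auto intro!: derivative_eq_intros simp: algebra_simps)

lemma signed_curvature_arc:
  "signed_curvature (arc_x p) (arc_y q) t =
     - q / sqrt ((1 + p * (1 - 2 * t))\<^sup>2 + (q * (1 - 2 * t))\<^sup>2) ^ 3"
proof -
  let ?R = "(1 + p * (1 - 2 * t))\<^sup>2 + (q * (1 - 2 * t))\<^sup>2"
  have "(2 + 2 * p * (1 - 2 * t))\<^sup>2 + (2 * q * (1 - 2 * t))\<^sup>2 = 2\<^sup>2 * ?R"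
    by (simp add: power2_eq_square algebra_simps)
  then have "sqrt ((2 + 2 * p * (1 - 2 * t))\<^sup>2 + (2 * q * (1 - 2 * t))\<^sup>2) ^ 3 = 8 * sqrt ?R ^ 3"
    by (simp only: real_sqrt_mult) (simp add: power_mult_distrib)
  moreover have "(2 + 2 * p * (1 - 2 * t)) * (- 4 * q) - 2 * q * (1 - 2 * t) * (- 4 * p) = 8 * (- q)"
    by (simp add: algebra_simps)
  ultimately show ?thesis
    unfolding signed_curvature_def deriv2_arc_x deriv2_arc_y unfolding deriv_arc_x deriv_arc_y
    by simp
qed

lemma curv_a_eq: "curv_a p q = signed_curvature (arc_x p) (arc_y q) 0"
  by (simp add: signed_curvature_arc curv_a_def h1_def)

lemma curv_b_eq: "curv_b p q = signed_curvature (arc_x p) (arc_y q) 1"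
  by (simp add: signed_curvature_arc curv_b_def h2_def)

(* Distinct control points give arcs that differ even as point sets,
   so arcs may be counted by their control points. *)

lemma arc_determines_control_point:
  assumes "q \<noteq> 0" "q' \<noteq> 0"
    and eq: "(\<lambda>t. (arc_x p t, arc_y q t)) ` {0..1} = (\<lambda>t. (arc_x p' t, arc_y q' t)) ` {0..1}"
  shows "p = p' \<and> q = q'"
proof -
  have bd: "\<exists>c. 0 \<le> c \<and> c \<le> 1 \<and> q = q' * c \<and> (c = 1 \<longrightarrow> p = p')"
    if same: "(\<lambda>t. (arc_x p t, arc_y q t)) ` {0..1} = (\<lambda>t. (arc_x p' t, arc_y q' t)) ` {0..1}"
    for p q p' q' :: real
  proof -
    have "(arc_x p (1/2), arc_y q (1/2)) \<in> (\<lambda>t. (arc_x p t, arc_y q t)) ` {0..1}"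
      by (intro image_eqI[of _ _ "1/2"]) auto
    then obtain t where t: "0 \<le> t" "t \<le> 1" and x: "arc_x p (1/2) = arc_x p' t"
      and y: "arc_y q (1/2) = arc_y q' t"
      unfolding same by auto
    let ?c = "4 * t * (1 - t)"
    have c: "?c = 1 - (1 - 2 * t)\<^sup>2"
      by (simp add: power2_eq_square algebra_simps)
    have "q = q' * ?c"
      using y by (simp add: arc_y_def field_simps)
    moreover have "0 \<le> ?c"
      using t by simp
    moreover have "?c \<le> 1"
      unfolding c by simp
    moreover have "p = p'" if "?c = 1"
    proof -
      have "t = 1/2"
        using that c by simp
      with x show ?thesis
        by (simp add: arc_x_def)
    qed
    ultimately show ?thesis
      by blast
  qed
  obtain c where c: "0 \<le> c" "c \<le> 1" "q = q' * c" "c = 1 \<longrightarrow> p = p'"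
    using bd[OF eq] by blast
  obtain d where d: "0 \<le> d" "d \<le> 1" "q' = q * d"
    using bd[OF eq[symmetric]] by blast
  have "c * d = 1"
    using c(3) d(3) assms(1) by (simp add: mult.commute)
  then have "c = 1"
    using c d mult_left_le[of d c] by linarith
  with c show ?thesis
    by simp
qed

end

theory Submission
  imports Defs
begin

text \<open>
  Once \<open>\<sigma> = \<alpha> + \<beta>\<close> is prescribed, one degree of freedom remains; the right coordinate for it is
  the difference \<open>\<tau> = \<alpha> - \<beta>\<close>, up to sign the angle through which the tangent turns along the arc.
  The sides of the control polygon and its base form a triangle, and the sine rule turns the
  pair \<open>(\<sigma>, \<tau>)\<close> into rational formulas for the control point,
  \<open>p = - sin \<sigma> / sin \<tau>\<close> and \<open>q = (cos \<sigma> - cos \<tau>) / sin \<tau>\<close>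
  (lemma \<open>sigma_eq_iff\<close>). Write \<open>c = cos \<sigma>\<close> and \<open>y = cos \<tau> < c\<close>. Changing the
  sign of \<open>sin \<tau>\<close> reflects the control point in the origin, which affects neither of the remaining
  conditions; both can therefore be expressed through \<open>y\<close>:

  \<^item> The curvature is a monotone function of the squared speed, a quadratic polynomial in \<open>t\<close>, so
    the arc is spiral when the vertex of this quadratic is not interior, that is, when
    \<open>p\<^sup>2 + q\<^sup>2 \<le> \<bar>p\<bar>\<close>. In terms of \<open>y\<close> this factors into
    \<open>(1 + c) (1 - y)^3 \<le> (1 - c) (1 + y)^3\<close>. Since \<open>(1 - c) / (1 + c)\<close> is
    \<open>(tan (\<sigma> / 2))\<^sup>2 = w^6\<close>, the cube roots give \<open>y \<ge> v\<close> with
    \<open>v = (1 - w\<^sup>2) / (1 + w\<^sup>2)\<close>; this is where the cube root \<open>w\<close> comes from.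

  \<^item> \<open>Q\<close> becomes a rational function of \<open>y\<close> whose derivative is \<open>-3/8\<close> times the square of
    \<open>(1 + y\<^sup>2 - 2 y c) / (c - y)\<close>. It is therefore strictly decreasing; it tends to
    minus infinity as \<open>y\<close> approaches \<open>c\<close>, and its value at \<open>v\<close> is \<open>Q_max\<close>.

  So \<open>[v, c)\<close> is mapped bijectively onto the values at most \<open>Q_max\<close>, there is exactly one
  admissible \<open>y\<close>, and the two choices of sign of \<open>sin \<tau>\<close> produce two control points, which are
  symmetric with respect to the origin.
\<close>

section \<open>Spiral parabolic arcs\<close>

text \<open>
  A quarter of the squared speed, \<open>R\<close> in the proof, is a quadratic in \<open>1 - 2 t\<close> with vertex at
  \<open>- p / (p\<^sup>2 + q\<^sup>2)\<close>, and the curvature is \<open>- q\<close> divided by a power of it. The right-hand side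
  says that the vertex lies outside the open interval \<open>(-1, 1)\<close>, or equivalently that the control point
  lies in one of the two closed discs whose diameters join the origin to \<open>(\<plusminus>1, 0)\<close>.
\<close>

lemma spiral_arc_iff:
  assumes "q \<noteq> 0"
  shows "spiral_arc (arc_x p) (arc_y q) \<longleftrightarrow> p\<^sup>2 + q\<^sup>2 \<le> \<bar>p\<bar>"
proof -
  define m where "m = p\<^sup>2 + q\<^sup>2"
  define R where "R t = 1 + 2 * p * (1 - 2 * t) + m * (1 - 2 * t)\<^sup>2" for t
  let ?k = "signed_curvature (arc_x p) (arc_y q)"
  have m: "m > 0"
    using assms by (simp add: m_def sum_power2_gt_zero_iff)
  have R_eq: "R t = (1 + p * (1 - 2 * t))\<^sup>2 + (q * (1 - 2 * t))\<^sup>2" for t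
    by (simp add: R_def m_def power2_eq_square algebra_simps)
  have R_pos: "R t > 0" for t
  proof (cases "t = 1/2")
    case False
    then show ?thesis
      unfolding R_eq using assms by (simp add: sum_power2_gt_zero_iff)
  next
    case True
    show ?thesis
      unfolding R_def True by simp
  qed
  have k: "?k t = - q / sqrt (R t) ^ 3" for t
    by (simp add: signed_curvature_arc R_eq)
  have R_diff: "R t - R s = 4 * (s - t) * (p + m * (1 - s - t))" for s t
    by (simp add: R_def power2_eq_square algebra_simps)
  have k_le: "?k s \<le> ?k t \<longleftrightarrow> q * R s \<le> q * R t" for s t
  proof -
    have le: "inverse (sqrt (R s) ^ 3) \<le> inverse (sqrt (R t) ^ 3) \<longleftrightarrow> R t \<le> R s" for s t
      using R_pos[of s] R_pos[of t] by (simp add: power_mono_iff)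
    show ?thesis
      using assms le[of s t] le[of t s]
      by (auto simp: k divide_inverse mult_le_cancel_left)
  qed
  show ?thesis
  proof
    assume "spiral_arc (arc_x p) (arc_y q)"
    then have mono: "mono_on {0..1} ?k \<or> antimono_on {0..1} ?k"
      by (simp add: spiral_arc_def)
    show "p\<^sup>2 + q\<^sup>2 \<le> \<bar>p\<bar>"
    proof (rule ccontr)
      assume "\<not> ?thesis"
      then have pm: "\<bar>p\<bar> < m"
        by (simp add: m_def)
      \<comment> \<open>\<open>R\<close> has its vertex at the interior parameter \<open>t\<close> and is symmetric about it, so monotone
        curvature would have to be constant between \<open>t - d\<close> and \<open>t + d\<close>.\<close>
      define t where "t = (1 + p / m) / 2"
      define d where "d = min t (1 - t)"
      have "- 1 < p / m" "p / m < 1"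
        using pm m by (auto simp: field_simps)
      then have t: "0 < t" "t < 1"
        by (auto simp: t_def)
      have vertex: "m * (1 - 2 * t) = - p"
        using m by (simp add: t_def field_simps)
      have sym: "R (t - d) = R (t + d)"
      proof -
        have "p + m * (1 - (t + d) - (t - d)) = 0"
          using vertex by (simp add: algebra_simps)
        then show ?thesis
          using R_diff[of "t - d" "t + d"] by simp
      qed
      have d: "0 < d" "0 \<le> t - d" "t + d \<le> 1"
        using t by (auto simp: d_def)
      have "p + m * (1 - (t - d) - t) = m * d"
        using vertex by (simp add: algebra_simps)
      then have "R t - R (t - d) = - 4 * d * (m * d)"
        using R_diff[of t "t - d"] by simp
      moreover have "0 < d * (m * d)"
        using d m by simp
      ultimately have less: "R t \<noteq> R (t - d)"
        by simp
      have "(?k (t - d) \<le> ?k t \<and> ?k t \<le> ?k (t + d)) \<or> (?k t \<le> ?k (t - d) \<and> ?k (t + d) \<le> ?k t)"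
        using mono
      proof
        assume "mono_on {0..1} ?k"
        then show ?thesis
          using d t by (auto simp: monotone_on_def)
      next
        assume "antimono_on {0..1} ?k"
        then show ?thesis
          using d t by (auto simp: monotone_on_def)
      qed
      then have "q * R t = q * R (t - d)"
        unfolding k_le sym by linarith
      with less assms show False
        by simp
    qed
  next
    assume "p\<^sup>2 + q\<^sup>2 \<le> \<bar>p\<bar>"
    then have pm: "m \<le> \<bar>p\<bar>"
      by (simp add: m_def)
    have bound: "\<bar>m * (1 - s - t)\<bar> \<le> m" if "s \<in> {0..1}" "t \<in> {0..1}" for s t
      using that m by (auto simp: abs_mult intro!: mult_left_le)
    have R_mono: "0 \<le> p * (R s - R t)" if "s \<in> {0..1}" "t \<in> {0..1}" "s \<le> t" for s t
    proof -
      have "0 \<le> p * (p + m * (1 - t - s))"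
        using bound[of t s] pm that by (intro zero_le_mult_iff[THEN iffD2]) auto
      then have "0 \<le> 4 * (t - s) * (p * (p + m * (1 - t - s)))"
        using that by simp
      then show ?thesis
        by (simp add: R_diff algebra_simps)
    qed
    have "mono_on {0..1} ?k \<or> antimono_on {0..1} ?k"
    proof (cases "p * q < 0")
      case True
      have "mono_on {0..1} ?k"
        unfolding monotone_on_def k_le using R_mono True
        by (smt (verit) mult_le_cancel_left mult_less_0_iff zero_le_mult_iff)
      then show ?thesis ..
    next
      case False
      have "p \<noteq> 0"
        using pm m by auto
      then have "antimono_on {0..1} ?k"
        unfolding monotone_on_def k_le using R_mono False assms
        by (smt (verit) mult_le_cancel_left mult_less_0_iff zero_le_mult_iff)
      then show ?thesis ..
    qed
    moreover have "\<not> ?k constant_on {0..1}"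
    proof
      assume "?k constant_on {0..1}"
      then have "?k 0 = ?k 1"
        unfolding constant_on_def by (metis atLeastAtMost_iff order_refl zero_le_one)
      then have "q * R 0 = q * R 1"
        using k_le[of 0 1] k_le[of 1 0] by linarith
      then have "p = 0"
        using assms R_diff[of 0 1] by simp
      with pm m show False
        by simp
    qed
    ultimately show "spiral_arc (arc_x p) (arc_y q)"
      by (simp add: spiral_arc_def)
  qed
qed

section \<open>Control points with a given sum of tangent angles\<close>

text \<open>
  The sines of the two angles have opposite signs, so the angles lie on opposite sides of \<open>0\<close>. Hence
  no multiple of \<open>2 * pi\<close> is lost when their sum is recovered from its sine and cosine.
\<close>

lemma sigma_bounds:
  assumes "q \<noteq> 0"
  shows "- pi < sigma p q" "sigma p q < pi"
proof -
  have a: "- pi < alpha p q" "alpha p q < pi" "sin (alpha p q) = q / h1 p q"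
    and b: "- pi < beta p q" "beta p q < pi" "sin (beta p q) = - q / h2 p q"
    using alpha_angle[OF assms] beta_angle[OF assms] by auto
  have h: "h1 p q > 0" "h2 p q > 0"
    using assms by (auto simp: h1_def h2_def sum_power2_gt_zero_iff)
  have "- pi < sigma p q \<and> sigma p q < pi"
  proof (cases "q > 0")
    case True
    then have "sin (alpha p q) > 0" "sin (beta p q) < 0"
      using a(3) b(3) h by simp_all
    then have "alpha p q > 0" "beta p q < 0"
      using a b sin_ge_zero[of "beta p q"] sin_ge_zero[of "- alpha p q"] by fastforce+
    then show ?thesis
      using a b by (simp add: sigma_def)
  next
    case False
    then have "sin (alpha p q) < 0" "sin (beta p q) > 0"
      using h assms unfolding a(3) b(3) by (auto intro: divide_neg_pos divide_pos_pos)
    then have "alpha p q < 0" "beta p q > 0"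
      using a b sin_ge_zero[of "alpha p q"] sin_ge_zero[of "- beta p q"] by fastforce+
    then show ?thesis
      using a b by (simp add: sigma_def)
  qed
  then show "- pi < sigma p q" "sigma p q < pi"
    by auto
qed

lemma cos_sin_sigma:
  assumes "q \<noteq> 0"
  shows "h1 p q * h2 p q * cos (sigma p q) = 1 - p\<^sup>2 + q\<^sup>2"
    and "h1 p q * h2 p q * sin (sigma p q) = - 2 * p * q"
proof -
  have h: "h1 p q > 0" "h2 p q > 0"
    using assms by (auto simp: h1_def h2_def sum_power2_gt_zero_iff)
  have a: "h1 p q * cos (alpha p q) = 1 + p" "h1 p q * sin (alpha p q) = q"
    and b: "h2 p q * cos (beta p q) = 1 - p" "h2 p q * sin (beta p q) = - q"
    using alpha_angle[OF assms, of p] beta_angle[OF assms, of p] h by simp_all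
  have "h1 p q * h2 p q * cos (sigma p q)
      = h1 p q * cos (alpha p q) * (h2 p q * cos (beta p q))
        - h1 p q * sin (alpha p q) * (h2 p q * sin (beta p q))"
    by (simp add: sigma_def cos_add algebra_simps)
  then show "h1 p q * h2 p q * cos (sigma p q) = 1 - p\<^sup>2 + q\<^sup>2"
    unfolding a b by (simp add: power2_eq_square algebra_simps)
  have "h1 p q * h2 p q * sin (sigma p q)
      = h1 p q * sin (alpha p q) * (h2 p q * cos (beta p q))
        + h1 p q * cos (alpha p q) * (h2 p q * sin (beta p q))"
    by (simp add: sigma_def sin_add algebra_simps)
  then show "h1 p q * h2 p q * sin (sigma p q) = - 2 * p * q"
    unfolding a b by (simp add: algebra_simps)
qed

text \<open>
  The product \<open>h1 p q * h2 p q\<close> is \<open>\<bar>1 - z\<^sup>2\<bar>\<close> for the complex number \<open>z = p + q i\<close>.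
  Of the two sums of squares, the first belongs to \<open>\<alpha> + \<beta>\<close> and the second to \<open>\<alpha> - \<beta>\<close>, each
  having the cosine and sine of that angle, multiplied by the product, as its terms up to sign.
\<close>

lemma h1_h2_power2:
  "(h1 p q * h2 p q)\<^sup>2 = (1 - p\<^sup>2 + q\<^sup>2)\<^sup>2 + (2 * p * q)\<^sup>2"
  "(h1 p q * h2 p q)\<^sup>2 = (1 - p\<^sup>2 - q\<^sup>2)\<^sup>2 + (2 * q)\<^sup>2"
proof -
  have "(h1 p q * h2 p q)\<^sup>2 = ((1 + p)\<^sup>2 + q\<^sup>2) * ((1 - p)\<^sup>2 + q\<^sup>2)"
    by (simp add: h1_def h2_def power_mult_distrib)
  then show "(h1 p q * h2 p q)\<^sup>2 = (1 - p\<^sup>2 + q\<^sup>2)\<^sup>2 + (2 * p * q)\<^sup>2"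
    "(h1 p q * h2 p q)\<^sup>2 = (1 - p\<^sup>2 - q\<^sup>2)\<^sup>2 + (2 * q)\<^sup>2"
    by (simp_all add: power2_eq_square algebra_simps)
qed

text \<open>
  The parametrisation behind everything that follows: \<open>(y, d)\<close> is the point
  \<open>(cos (\<alpha> - \<beta>), sin (\<alpha> - \<beta>))\<close> of the unit circle. The condition on \<open>y\<close> reflects that
  \<open>cos (\<alpha> + \<beta>) - cos (\<alpha> - \<beta>) = - 2 sin \<alpha> sin \<beta>\<close> is positive, the sines
  having opposite signs.
\<close>

lemma sigma_eq_iff:
  assumes "q \<noteq> 0" and "\<bar>\<sigma>\<bar> < pi"
  shows "sigma p q = \<sigma> \<longleftrightarrow>
    (\<exists>y d. y\<^sup>2 + d\<^sup>2 = 1 \<and> d \<noteq> 0 \<and> y < cos \<sigma> \<and> p = - sin \<sigma> / d \<and> q = (cos \<sigma> - y) / d)"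
    (is "_ \<longleftrightarrow> ?R")
proof -
  define r where "r = h1 p q * h2 p q"
  have r: "r > 0"
    using assms by (auto simp: r_def h1_def h2_def sum_power2_gt_zero_iff)
  note r2 = h1_h2_power2[of p q, folded r_def]
  note cs = cos_sin_sigma[OF assms(1), of p, folded r_def]
  show ?thesis
  proof
    assume s: "sigma p q = \<sigma>"
    define y where "y = (1 - p\<^sup>2 - q\<^sup>2) / r"
    define d where "d = 2 * q / r"
    have c: "cos \<sigma> = (1 - p\<^sup>2 + q\<^sup>2) / r" and S: "sin \<sigma> = - 2 * p * q / r"
      using cs r unfolding s by (simp_all add: field_simps)
    have "y\<^sup>2 + d\<^sup>2 = 1"
    proof -
      have "y\<^sup>2 + d\<^sup>2 = r\<^sup>2 / r\<^sup>2"
        unfolding y_def d_def power_divide r2(2) add_divide_distrib ..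
      then show ?thesis
        using r by simp
    qed
    moreover have "d \<noteq> 0"
      using r assms by (simp add: d_def)
    moreover
    have diff: "cos \<sigma> - y = 2 * q\<^sup>2 / r"
      by (simp add: c y_def flip: diff_divide_distrib)
    have "2 * q\<^sup>2 / r > 0"
      using r assms by simp
    then have "y < cos \<sigma>"
      using diff by simp
    moreover have "p = - sin \<sigma> / d" "q = (cos \<sigma> - y) / d"
      using r assms unfolding diff S by (simp_all add: d_def power2_eq_square)
    ultimately show ?R
      by - (rule exI[of _ y], rule exI[of _ d], intro conjI)
  next
    assume ?R
    then obtain y d where yd: "y\<^sup>2 + d\<^sup>2 = 1" "d \<noteq> 0" "y < cos \<sigma>"
      and p: "p = - sin \<sigma> / d" and q: "q = (cos \<sigma> - y) / d"
      by blast
    \<comment> \<open>\<open>k\<close> is the product \<open>h1 p q * h2 p q\<close>; that the two agree is shown by comparing the sums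
      of squares.\<close>
    define k where "k = 2 * (cos \<sigma> - y) / d\<^sup>2"
    have k: "k > 0"
      using yd by (simp add: k_def)
    have d2: "d\<^sup>2 = 1 - y\<^sup>2"
      using yd by simp
    have "d\<^sup>2 * (1 - p\<^sup>2 + q\<^sup>2) = d\<^sup>2 - (sin \<sigma>)\<^sup>2 + (cos \<sigma> - y)\<^sup>2"
      using yd by (simp add: p q field_simps)
    also have "\<dots> = 2 * (cos \<sigma> - y) * cos \<sigma>"
      unfolding sin_squared_eq d2 by (simp add: power2_eq_square algebra_simps)
    finally have c: "1 - p\<^sup>2 + q\<^sup>2 = k * cos \<sigma>"
      using yd by (simp add: k_def field_simps)
    have S: "- 2 * p * q = k * sin \<sigma>"
      using yd by (simp add: k_def p q field_simps power2_eq_square)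
    have "r\<^sup>2 = (k * cos \<sigma>)\<^sup>2 + (k * sin \<sigma>)\<^sup>2"
      using r2(1) c S by (metis minus_mult_left power2_minus)
    also have "\<dots> = k\<^sup>2"
      by (simp add: power_mult_distrib flip: distrib_left)
    finally have "r = k"
      using r k by (simp add: power2_eq_iff_nonneg)
    then have "cos (sigma p q) = cos \<sigma>" "sin (sigma p q) = sin \<sigma>"
      using cs c S k by simp_all
    then obtain n :: int where n: "sigma p q = \<sigma> + 2 * pi * n"
      using sin_cos_eq_iff by auto
    have "\<bar>2 * pi * n\<bar> < 2 * pi * 1"
      using sigma_bounds[OF assms(1), of p] assms(2) n by linarith
    then have "\<bar>real_of_int n\<bar> < 1"
      by (simp add: abs_mult)
    then have "n = 0"
      by linarith
    then show "sigma p q = \<sigma>"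
      using n by simp
  qed
qed

section \<open>The spiral condition and the value of Q in terms of the turning angle\<close>

text \<open>
  Squaring the left-hand side gives a polynomial inequality that is quadratic in \<open>cos \<sigma>\<close>. One of its roots
  is \<open>cos \<sigma> = y\<close>, outside the admissible range, and the factor that remains is the
  difference of the two sides on the right.
\<close>

lemma spiral_condition_turning:
  fixes y d \<sigma> :: real
  assumes "y\<^sup>2 + d\<^sup>2 = 1" "d \<noteq> 0" "y < cos \<sigma>"
    and p: "p = - sin \<sigma> / d" and q: "q = (cos \<sigma> - y) / d"
  shows "p\<^sup>2 + q\<^sup>2 \<le> \<bar>p\<bar> \<longleftrightarrow> (1 + cos \<sigma>) * (1 - y) ^ 3 \<le> (1 - cos \<sigma>) * (1 + y) ^ 3"
proof -
  let ?c = "cos \<sigma>"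
  have d2: "d\<^sup>2 = 1 - y\<^sup>2"
    using assms(1) by simp
  have m: "d\<^sup>2 * (p\<^sup>2 + q\<^sup>2) = 1 + y\<^sup>2 - 2 * y * ?c"
  proof -
    have "d\<^sup>2 * (p\<^sup>2 + q\<^sup>2) = (sin \<sigma>)\<^sup>2 + (?c - y)\<^sup>2"
      using assms(2) by (simp add: p q field_simps)
    also have "\<dots> = 1 + y\<^sup>2 - 2 * y * ?c"
      by (simp add: sin_squared_eq power2_eq_square algebra_simps)
    finally show ?thesis .
  qed
  have P: "d\<^sup>2 * p\<^sup>2 = 1 - ?c\<^sup>2"
    using assms(2) by (simp add: p field_simps sin_squared_eq)
  have "p\<^sup>2 + q\<^sup>2 \<le> \<bar>p\<bar> \<longleftrightarrow> (p\<^sup>2 + q\<^sup>2)\<^sup>2 \<le> p\<^sup>2"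
    using abs_le_square_iff[of "p\<^sup>2 + q\<^sup>2" p] by simp
  also have "\<dots> \<longleftrightarrow> (d\<^sup>2)\<^sup>2 * (p\<^sup>2 + q\<^sup>2)\<^sup>2 \<le> (d\<^sup>2)\<^sup>2 * p\<^sup>2"
    using assms(2) by simp
  also have "(d\<^sup>2)\<^sup>2 * (p\<^sup>2 + q\<^sup>2)\<^sup>2 = (1 + y\<^sup>2 - 2 * y * ?c)\<^sup>2"
    using m by (metis power_mult_distrib)
  also have "(d\<^sup>2)\<^sup>2 * p\<^sup>2 = (1 - y\<^sup>2) * (1 - ?c\<^sup>2)"
  proof -
    have "(d\<^sup>2)\<^sup>2 * p\<^sup>2 = d\<^sup>2 * (d\<^sup>2 * p\<^sup>2)"
      by (simp add: power2_eq_square)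
    also have "\<dots> = (1 - y\<^sup>2) * (1 - ?c\<^sup>2)"
      by (subst P) (simp only: d2)
    finally show ?thesis .
  qed
  also have "(1 + y\<^sup>2 - 2 * y * ?c)\<^sup>2 \<le> (1 - y\<^sup>2) * (1 - ?c\<^sup>2)
      \<longleftrightarrow> (?c - y) * ((1 + ?c) * (1 - y) ^ 3 - (1 - ?c) * (1 + y) ^ 3) \<le> 0"
  proof -
    have "(?c - y) * ((1 + ?c) * (1 - y) ^ 3 - (1 - ?c) * (1 + y) ^ 3)
        = 2 * ((1 + y\<^sup>2 - 2 * y * ?c)\<^sup>2 - (1 - y\<^sup>2) * (1 - ?c\<^sup>2))"
      by (simp add: power2_eq_square power3_eq_cube algebra_simps)
    then show ?thesis
      by auto
  qed
  also have "\<dots> \<longleftrightarrow> (1 + ?c) * (1 - y) ^ 3 \<le> (1 - ?c) * (1 + y) ^ 3"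
    using assms(3) by (simp add: mult_le_0_iff)
  finally show ?thesis .
qed

text \<open>
  The invariant \<open>Q\<close> as a function of \<open>c = cos (\<alpha> + \<beta>)\<close> and \<open>y = cos (\<alpha> - \<beta>)\<close>.
\<close>

definition Q_turning :: "real \<Rightarrow> real \<Rightarrow> real" where
  "Q_turning c y = (1 - y ^ 3) / 2 - 3 * (1 - y\<^sup>2)\<^sup>2 / (8 * (c - y))"

lemma Q_eq:
  assumes "q \<noteq> 0"
  shows "Q p q = q\<^sup>2 * ((p\<^sup>2 + q\<^sup>2)\<^sup>2 - 4 * p\<^sup>2) / (h1 p q * h2 p q) ^ 3 + (1 - cos (sigma p q)) / 2"
proof -
  have h: "h1 p q > 0" "h2 p q > 0"
    using assms by (auto simp: h1_def h2_def sum_power2_gt_zero_iff)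
  have h2: "(h1 p q)\<^sup>2 = (1 + p)\<^sup>2 + q\<^sup>2" "(h2 p q)\<^sup>2 = (1 - p)\<^sup>2 + q\<^sup>2"
    by (simp_all add: h1_def h2_def)
  have half: "(sin (x / 2))\<^sup>2 = (1 - cos x) / 2" for x :: real
    using cos_double_sin[of "x / 2"] by simp
  have "curv_a p q + sin (alpha p q) = q * ((h1 p q)\<^sup>2 - 1) / h1 p q ^ 3"
    using alpha_angle[OF assms, of p] h
    by (simp add: curv_a_def field_simps power2_eq_square power3_eq_cube)
  moreover have "curv_b p q - sin (beta p q) = q * ((h2 p q)\<^sup>2 - 1) / h2 p q ^ 3"
    using beta_angle[OF assms, of p] h
    by (simp add: curv_b_def field_simps power2_eq_square power3_eq_cube)
  ultimately have "Q p q = q * ((h1 p q)\<^sup>2 - 1) / h1 p q ^ 3 * (q * ((h2 p q)\<^sup>2 - 1) / h2 p q ^ 3)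
      + (1 - cos (sigma p q)) / 2"
    by (simp add: Q_def half sigma_def)
  also have "q * ((h1 p q)\<^sup>2 - 1) / h1 p q ^ 3 * (q * ((h2 p q)\<^sup>2 - 1) / h2 p q ^ 3)
      = q\<^sup>2 * (((h1 p q)\<^sup>2 - 1) * ((h2 p q)\<^sup>2 - 1)) / (h1 p q * h2 p q) ^ 3"
    by (simp add: power_mult_distrib power2_eq_square[of q])
  also have "((h1 p q)\<^sup>2 - 1) * ((h2 p q)\<^sup>2 - 1) = (p\<^sup>2 + q\<^sup>2)\<^sup>2 - 4 * p\<^sup>2"
    unfolding h2 by (simp add: power2_eq_square algebra_simps)
  finally show ?thesis .
qed

lemma Q_eq_Q_turning:
  fixes y d \<sigma> :: real
  assumes "y\<^sup>2 + d\<^sup>2 = 1" "d \<noteq> 0" "y < cos \<sigma>" "\<bar>\<sigma>\<bar> < pi"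
    and p: "p = - sin \<sigma> / d" and q: "q = (cos \<sigma> - y) / d"
  shows "Q p q = Q_turning (cos \<sigma>) y"
proof -
  let ?c = "cos \<sigma>"
  define e where "e = ?c - y"
  define r where "r = h1 p q * h2 p q"
  have e: "e > 0"
    using assms(3) by (simp add: e_def)
  have q0: "q \<noteq> 0"
    using assms by simp
  have sigma: "sigma p q = \<sigma>"
    using sigma_eq_iff[OF q0 assms(4)] assms by blast
  have d2: "d\<^sup>2 = 1 - y\<^sup>2"
    using assms(1) by simp
  have r: "r > 0"
    using q0 by (auto simp: r_def h1_def h2_def sum_power2_gt_zero_iff)
  have qd: "q = e / d"
    by (simp add: q e_def)
  have m: "p\<^sup>2 + q\<^sup>2 = (1 + y\<^sup>2 - 2 * y * ?c) / d\<^sup>2"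
    using assms(2)
    by (simp add: p q field_simps) (simp add: sin_squared_eq power2_eq_square algebra_simps)
  have P: "p\<^sup>2 = (1 - ?c\<^sup>2) / d\<^sup>2"
    using assms(2) by (simp add: p power_divide sin_squared_eq)
  \<comment> \<open>The sum of squares for \<open>\<alpha> - \<beta>\<close> makes the square root in \<open>r\<close> disappear.\<close>
  have "(d\<^sup>2 * r)\<^sup>2 = (d\<^sup>2 * (1 - (p\<^sup>2 + q\<^sup>2)))\<^sup>2 + d\<^sup>2 * (2 * (d * q))\<^sup>2"
    unfolding power_mult_distrib[of "d\<^sup>2" r] h1_h2_power2(2)[of p q, folded r_def]
    by (simp add: power2_eq_square algebra_simps)
  also have "d\<^sup>2 * (1 - (p\<^sup>2 + q\<^sup>2)) = 2 * y * e"
  proof -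
    have "d\<^sup>2 * (1 - (p\<^sup>2 + q\<^sup>2)) = d\<^sup>2 - (1 + y\<^sup>2 - 2 * y * ?c)"
      unfolding right_diff_distrib[of "d\<^sup>2" 1] m using assms(2) by simp
    also have "\<dots> = 2 * y * e"
      using assms(1) by (simp add: e_def power2_eq_square algebra_simps)
    finally show ?thesis .
  qed
  also have "d * q = e"
    using assms(2) qd by simp
  also have "(2 * y * e)\<^sup>2 + d\<^sup>2 * (2 * e)\<^sup>2 = (2 * e)\<^sup>2"
    unfolding d2 by (simp add: power2_eq_square algebra_simps)
  finally have "d\<^sup>2 * r = 2 * e"
    by (rule power2_eq_imp_eq) (use r e in simp_all)
  then have r_eq: "r = 2 * e / d\<^sup>2"
    using assms(2) by (simp add: field_simps)
  have "q\<^sup>2 * ((p\<^sup>2 + q\<^sup>2)\<^sup>2 - 4 * p\<^sup>2) / r ^ 3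
      = e\<^sup>2 / d\<^sup>2 * (((1 + y\<^sup>2 - 2 * y * ?c) / d\<^sup>2)\<^sup>2 - 4 * ((1 - ?c\<^sup>2) / d\<^sup>2)) / (2 * e / d\<^sup>2) ^ 3"
    unfolding m unfolding P r_eq by (simp add: qd power_divide)
  also have "\<dots> = ((1 + y\<^sup>2 - 2 * y * ?c)\<^sup>2 - 4 * (1 - ?c\<^sup>2) * d\<^sup>2) / (8 * e)"
    using e assms(2) by (simp add: field_simps eval_nat_numeral)
  finally have "Q p q = ((1 + y\<^sup>2 - 2 * y * ?c)\<^sup>2 - 4 * (1 - ?c\<^sup>2) * (1 - y\<^sup>2)) / (8 * e)
      + (1 - ?c) / 2"
    using Q_eq[OF q0, of p] by (simp add: sigma r_def[symmetric] d2)
  also have "\<dots> = ((1 + y\<^sup>2 - 2 * y * ?c)\<^sup>2 - 4 * (1 - ?c\<^sup>2) * (1 - y\<^sup>2) + 4 * e * (1 - ?c)) / (8 * e)"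
    using e by (simp add: field_simps)
  also have "(1 + y\<^sup>2 - 2 * y * ?c)\<^sup>2 - 4 * (1 - ?c\<^sup>2) * (1 - y\<^sup>2) + 4 * e * (1 - ?c)
      = 4 * e * (1 - y ^ 3) - 3 * (1 - y\<^sup>2)\<^sup>2"
    by (simp add: e_def power2_eq_square power3_eq_cube algebra_simps)
  also have "(4 * e * (1 - y ^ 3) - 3 * (1 - y\<^sup>2)\<^sup>2) / (8 * e) = Q_turning ?c y"
    using e by (simp add: Q_turning_def e_def[symmetric] field_simps)
  finally show ?thesis .
qed

section \<open>Solving for the turning angle\<close>

text \<open>
  The derivative is \<open>-3/8\<close> times a perfect square, and the numerator under the square is
  \<open>(y - c)\<^sup>2 + (1 - c\<^sup>2)\<close>, which never vanishes.
\<close>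

lemma Q_turning_strict_antimono:
  assumes "c < 1" "x < y" "y < c" "- 1 < c"
  shows "Q_turning c y < Q_turning c x"
proof (rule DERIV_neg_imp_decreasing[OF assms(2)])
  fix z assume z: "x \<le> z" "z \<le> y"
  let ?D = "- (3 / 8) * ((1 + z\<^sup>2 - 2 * z * c) / (c - z))\<^sup>2"
  have "c - z \<noteq> 0"
    using z assms by simp
  then have "(Q_turning c has_real_derivative
      (- (3 * z\<^sup>2) / 2 - (24 * (1 - z\<^sup>2)\<^sup>2 - 96 * z * (1 - z\<^sup>2) * (c - z)) / (8 * (c - z))\<^sup>2)) (at z)"
    unfolding Q_turning_def[abs_def]
    by - ((rule derivative_eq_intros refl | simp)+, simp add: power2_eq_square algebra_simps)
  also have "- (3 * z\<^sup>2) / 2 - (24 * (1 - z\<^sup>2)\<^sup>2 - 96 * z * (1 - z\<^sup>2) * (c - z)) / (8 * (c - z))\<^sup>2 = ?D"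
  proof -
    define e where "e = c - z"
    have "1 + z\<^sup>2 - 2 * z * c = 1 - z\<^sup>2 - 2 * z * e"
      by (simp add: e_def power2_eq_square algebra_simps)
    moreover have "e \<noteq> 0"
      using \<open>c - z \<noteq> 0\<close> by (simp add: e_def)
    then have "- (3 * z\<^sup>2) / 2 - (24 * (1 - z\<^sup>2)\<^sup>2 - 96 * z * (1 - z\<^sup>2) * e) / (8 * e)\<^sup>2
        = - (3 / 8) * ((1 - z\<^sup>2 - 2 * z * e) / e)\<^sup>2"
      unfolding power_divide power_mult_distrib
      by (simp add: divide_simps) algebra
    ultimately show ?thesis
      by (simp only: e_def)
  qed
  finally have "(Q_turning c has_real_derivative ?D) (at z)" .
  moreover have "1 + z\<^sup>2 - 2 * z * c > 0"
  proof -
    have "0 < (z - c)\<^sup>2 + (1 - c) * (1 + c)"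
      using assms by (simp add: add_nonneg_pos)
    then show ?thesis
      by (simp add: power2_eq_square algebra_simps)
  qed
  then have "?D < 0"
    using \<open>c - z \<noteq> 0\<close> by simp
  ultimately show "\<exists>D. (Q_turning c has_real_derivative D) (at z) \<and> D < 0"
    by blast
qed

text \<open>
  \<open>Q_turning c\<close> has a pole at \<open>c\<close> and tends to minus infinity from the left. Multiplying by \<open>c - y\<close> removes
  the pole, and the intermediate value theorem applies to the resulting polynomial on the closed interval.
\<close>

lemma Q_turning_attains:
  assumes "\<bar>c\<bar> < 1" "v < c" "Q\<^sub>0 \<le> Q_turning c v"
  obtains y where "v \<le> y" "y < c" "Q_turning c y = Q\<^sub>0"
proof -
  define f where "f y = (c - y) * ((1 - y ^ 3) / 2 - Q\<^sub>0) - 3 / 8 * (1 - y\<^sup>2)\<^sup>2" for y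
  have f: "f y = (c - y) * (Q_turning c y - Q\<^sub>0)" if "y < c" for y
    using that by (simp add: f_def Q_turning_def field_simps)
  have "f c < 0"
  proof -
    have "c\<^sup>2 < 1"
      using assms(1) by (simp add: abs_square_less_1)
    then show ?thesis
      by (simp add: f_def)
  qed
  moreover have "0 \<le> f v"
    using f[of v] assms by simp
  ultimately obtain y where y: "v \<le> y" "y \<le> c" "f y = 0"
    using IVT2'[of f c 0 v] assms(2)
    by (force simp: f_def intro!: continuous_intros)
  with \<open>f c < 0\<close> have "y < c"
    by (cases "y = c") auto
  with y f[of y] show ?thesis
    by (intro that[of y]) auto
qed

section \<open>The two spiral arcs\<close>

theorem proposition4:
  fixes \<sigma>\<^sub>0 Q\<^sub>0 w Q_max :: real
  assumes "0 < \<bar>\<sigma>\<^sub>0\<bar>" and "\<bar>\<sigma>\<^sub>0\<bar> < pi / 2"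
    and "w = root 3 (tan (\<sigma>\<^sub>0 / 2))"
    and "Q_max = - (w ^ 6 * (w\<^sup>2 + 2) / ((1 - w\<^sup>2) * (w\<^sup>2 + 1) ^ 3))"
    and "Q\<^sub>0 \<le> Q_max"
  shows "card {(p, q). q \<noteq> 0 \<and> spiral_arc (arc_x p) (arc_y q) \<and>
                       Q p q = Q\<^sub>0 \<and> sigma p q = \<sigma>\<^sub>0} = 2"
proof -
  define c where "c = cos \<sigma>\<^sub>0"
  define W where "W = w\<^sup>2"
  \<comment> \<open>\<open>v\<close> is the value of \<open>y\<close> at which the spiral condition becomes an equality.\<close>
  define v where "v = (1 - W) / (1 + W)"
  have sigma: "\<bar>\<sigma>\<^sub>0\<bar> < pi"
    using assms(2) by simp
  have c0: "0 < c"
    unfolding c_def using assms(2) by (intro cos_gt_zero_pi) auto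
  have "cos \<bar>\<sigma>\<^sub>0\<bar> < cos 0"
    using assms sigma by (intro cos_monotone_0_pi) auto
  then have c1: "c < 1"
    by (simp add: c_def)
  have "w ^ 3 = tan (\<sigma>\<^sub>0 / 2)"
    by (simp add: assms(3) odd_real_root_pow)
  then have "W ^ 3 = (tan (\<sigma>\<^sub>0 / 2))\<^sup>2"
    unfolding W_def by (metis mult.commute power_mult)
  also have "\<dots> = (1 - c) / (1 + c)"
    using cos_double_sin[of "\<sigma>\<^sub>0 / 2"] cos_double_cos[of "\<sigma>\<^sub>0 / 2"]
    by (simp add: tan_def power_divide c_def)
  finally have W3: "W ^ 3 = (1 - c) / (1 + c)" .
  have W0: "0 < W"
    using W3 c0 c1 by (metis W_def divide_pos_pos add_pos_pos diff_gt_0_iff_gt power_eq_0_iff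
        zero_less_one zero_less_power2 less_irrefl power_zero_numeral)
  have W1: "W < 1"
  proof -
    have "W ^ 3 < 1 ^ 3"
      using W3 c0 by simp
    then show ?thesis
      by (rule power_less_imp_less_base) simp
  qed
  have W3pos: "0 < 1 + W ^ 3"
    using W0 by (simp add: add_pos_pos)
  have c_eq: "c = (1 - W ^ 3) / (1 + W ^ 3)"
    using W3 c0 W3pos by (simp add: field_simps)
  have cv: "c - v = 2 * W * (1 - W) / (1 + W ^ 3)"
  proof -
    have "c - v = (2 * W * (1 - W) * (1 + W)) / ((1 + W ^ 3) * (1 + W))"
      unfolding c_eq v_def using W0 W3pos
      by (subst diff_frac_eq) (auto simp: algebra_simps eval_nat_numeral)
    then show ?thesis
      using W0 by simp
  qed
  have vc: "v < c"
    using cv W0 W1 W3pos by (metis diff_gt_0_iff_gt divide_pos_pos mult_pos_pos zero_less_numeral)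
  have "Q_turning c v = Q_max"
  proof -
    have v1: "1 - v\<^sup>2 = 4 * W / (1 + W)\<^sup>2"
      using W0 by (simp add: v_def field_simps) (simp add: power2_eq_square algebra_simps)
    have a: "(1 - v ^ 3) / 2 = (3 * W + W ^ 3) / (1 + W) ^ 3"
    proof -
      have "(1 - v ^ 3) / 2 = ((1 + W) ^ 3 - (1 - W) ^ 3) / (2 * (1 + W) ^ 3)"
        using W0 by (simp only: v_def power_divide) (simp add: divide_simps)
      also have "(1 + W) ^ 3 - (1 - W) ^ 3 = 2 * (3 * W + W ^ 3)"
        by (simp add: power3_eq_cube algebra_simps)
      finally show ?thesis
        by (simp only: mult_divide_mult_cancel_left_if zero_neq_numeral[symmetric] if_False)
    qed
    have b: "3 * (1 - v\<^sup>2)\<^sup>2 / (8 * (c - v)) = 3 * W * (1 - W + W\<^sup>2) / ((1 + W) ^ 3 * (1 - W))"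
    proof -
      have fac: "1 + W ^ 3 = (1 + W) * (1 - W + W\<^sup>2)"
        by (simp add: power2_eq_square power3_eq_cube algebra_simps)
      have "1 - W + W\<^sup>2 \<noteq> 0"
        using fac W3pos by auto
      then show ?thesis
        unfolding v1 cv fac using W0 W1
        by (simp add: divide_simps) (simp add: eval_nat_numeral algebra_simps)
    qed
    have "Q_turning c v = ((3 * W + W ^ 3) * (1 - W) - 3 * W * (1 - W + W\<^sup>2)) / ((1 + W) ^ 3 * (1 - W))"
      unfolding Q_turning_def a b using W0 W1 by (simp add: diff_divide_distrib)
    also have "(3 * W + W ^ 3) * (1 - W) - 3 * W * (1 - W + W\<^sup>2) = - (W ^ 3 * (W + 2))"
      by (simp add: eval_nat_numeral algebra_simps)
    finally show ?thesis
      unfolding assms(4) W_def by (simp add: power_mult[symmetric] ac_simps)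
  qed
  with assms(5) c0 c1 vc obtain y where y: "v \<le> y" "y < c" "Q_turning c y = Q\<^sub>0"
    by (elim Q_turning_attains[of c v "Q\<^sub>0", rotated -1]) auto
  have spiral_y: "(1 + c) * (1 - y) ^ 3 \<le> (1 - c) * (1 + y) ^ 3"
  proof -
    have "1 - y \<le> W * (1 + y)"
      using y(1) W0 by (simp add: v_def field_simps)
    then have "(1 - y) ^ 3 \<le> (W * (1 + y)) ^ 3"
      using y(2) c1 by (intro power_mono) auto
    then have "(1 + c) * (1 - y) ^ 3 \<le> (1 + c) * (W * (1 + y)) ^ 3"
      using c0 by simp
    also have "\<dots> = (1 - c) * (1 + y) ^ 3"
      using W3 c0 by (simp add: power_mult_distrib)
    finally show ?thesis .
  qed
  have unique: "Q_turning c z = Q\<^sub>0 \<longleftrightarrow> z = y" if "z < c" for z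
    using Q_turning_strict_antimono[of c z y] Q_turning_strict_antimono[of c y z] y that c0 c1
    by (cases z y rule: linorder_cases) auto
  \<comment> \<open>The two solutions come from the two values \<open>\<plusminus>d\<close> of \<open>sin (\<alpha> - \<beta>)\<close>.\<close>
  define d where "d = sqrt (1 - y\<^sup>2)"
  have "0 < v"
    using W0 W1 by (simp add: v_def)
  then have "\<bar>y\<bar> < 1"
    using y c1 by auto
  then have d: "d > 0" "y\<^sup>2 + d\<^sup>2 = 1"
    by (simp_all add: d_def abs_square_less_1 less_imp_le)
  define P where "P = sin \<sigma>\<^sub>0 / d"
  define R where "R = (c - y) / d"
  have "R \<noteq> 0"
    using y d by (simp add: R_def)
  have "{(p, q). q \<noteq> 0 \<and> spiral_arc (arc_x p) (arc_y q) \<and> Q p q = Q\<^sub>0 \<and> sigma p q = \<sigma>\<^sub>0}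
      = {(- P, R), (P, - R)}" (is "?S = ?T")
  proof (intro equalityI subsetI)
    fix x assume "x \<in> ?S"
    then obtain p q where x: "x = (p, q)" and q: "q \<noteq> 0"
      and spiral: "p\<^sup>2 + q\<^sup>2 \<le> \<bar>p\<bar>" and Q: "Q p q = Q\<^sub>0" and s: "sigma p q = \<sigma>\<^sub>0"
      using spiral_arc_iff by auto
    obtain z e where z: "z\<^sup>2 + e\<^sup>2 = 1" "e \<noteq> 0" "z < c"
      and pq: "p = - sin \<sigma>\<^sub>0 / e" "q = (c - z) / e"
      using s sigma_eq_iff[OF q sigma] unfolding c_def by blast
    have "z = y"
      using Q_eq_Q_turning[of z e \<sigma>\<^sub>0 p q] z pq sigma unique Q by (simp add: c_def)
    then have "e\<^sup>2 = d\<^sup>2"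
      using z d by simp
    then have "e = d \<or> e = - d"
      by (simp add: power2_eq_iff)
    then show "x \<in> ?T"
      using \<open>z = y\<close> by (auto simp: x pq P_def R_def)
  next
    fix x assume "x \<in> ?T"
    then obtain e where e: "e = d \<or> e = - d" and x: "x = (- sin \<sigma>\<^sub>0 / e, (c - y) / e)"
    proof -
      from \<open>x \<in> ?T\<close> have "x = (- P, R) \<or> x = (P, - R)"
        by simp
      then show ?thesis
        using that[of d] that[of "- d"] by (auto simp: P_def R_def)
    qed
    define p where "p = - sin \<sigma>\<^sub>0 / e"
    define q where "q = (c - y) / e"
    have e': "y\<^sup>2 + e\<^sup>2 = 1" "e \<noteq> 0"
      using e d by auto
    have q0: "q \<noteq> 0"
      using y e' by (simp add: q_def)
    have "spiral_arc (arc_x p) (arc_y q)"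
      using spiral_condition_turning[of y e \<sigma>\<^sub>0 p q] e' y spiral_y spiral_arc_iff[OF q0]
      by (simp add: p_def q_def c_def)
    moreover have "Q p q = Q\<^sub>0"
      using Q_eq_Q_turning[of y e \<sigma>\<^sub>0 p q] e' y sigma by (simp add: p_def q_def c_def)
    moreover have "sigma p q = \<sigma>\<^sub>0"
      using sigma_eq_iff[OF q0 sigma, of p] e' y p_def q_def unfolding c_def by blast
    ultimately show "x \<in> ?S"
      using q0 by (simp add: x p_def q_def)
  qed
  moreover have "card ?T = 2"
    using \<open>R \<noteq> 0\<close> by (simp add: eq_neg_iff_add_eq_0)
  ultimately show ?thesis
    by simp
qed

end
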